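(* Let $\epsilon>0$ and let $K$ be any policy with finite $C(K)$. Let $\chi_K^{(l)}=\mathrm{diag}\Big(\sum_{t=0}^{l}X_1(t),\dots,\sum_{t=0}^{l}X_{N_s}(t)\Big)$, where $X_i(t)=\mathbb E[x_tx_t^\top\mathbf 1_{\omega(t)=i}]$ under policy $K$, and let $\chi_K=\mathrm{diag}\Big(\sum_{t=0}^{\infty}X_1(t),\dots,\sum_{t=0}^{\infty}X_{N_s}(t)\Big)$. If $$l\ \ge\ \frac{d\cdot C(K)^2}{\epsilon\,\mu\,\Lambda_{\min}(Q)^2},$$ then $\|\chi_K^{(l)}-\chi_K\|\le\epsilon$.
   Context: Setting (Markovian jump linear system). Let $\Omega=\{1,\dots,N_s\}$ and let $\omega(t)$, $t\ge0$, be a time-homogeneous Markov chain on $\Omega$ with transition probabilities $p_{ij}=\mathbb P(\omega(t+1)=j\mid\omega(t)=i)$ and initial distribution $\pi$. The state $x_t\in\mathbb R^d$ and control $u_t\in\mathbb R^k$ satisfy $x_{t+1}=A_{\omega(t)}x_t+B_{\omega(t)}u_t$, with $A_i\in\mathbb R^{d\times d}$, $B_i\in\mathbb R^{d\times k}$ and $x_0\sim D$ independent of the chain. A policy is a tuple $K=(K_1,\dots,K_{N_s})$, $K_i\in\mathbb R^{k\times d}$, acting by $u_t=-K_{\omega(t)}x_t$; its cost is $C(K)=\mathbb E_{x_0\sim D,\,\omega(0)\sim\pi}\big[\sum_{t=0}^\infty x_t^\top Q_{\omega(t)}x_t+u_t^\top R_{\omega(t)}u_t\big]$. Standing assumptions: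 all $Q_i\succ0$, all $R_i\succ0$, all $\pi_i>0$, $\mathbb E_{x_0\sim D}[x_0x_0^\top]\succ0$, and the system can be mean-square stabilized. Notation: $\|\cdot\|$ is the maximal singular value, $\Lambda_{\min}(Q)=\min_i\sigma_{\min}(Q_i)$, and $\mu=\min_i\pi_i\cdot\sigma_{\min}(\mathbb E_{x_0\sim D}[x_0x_0^\top])$. *)

theory Defs
  imports "HOL-Probability.Probability"
begin

section \<open>Matrices\<close>

definition outer :: "real ^ 'n \<Rightarrow> real ^ 'm \<Rightarrow> real ^ 'm ^ 'n" where
  "outer u v = (\<chi> a b. u $ a * v $ b)"

definition posdef :: "real ^ 'n ^ 'n \<Rightarrow> bool" where
  "posdef A \<longleftrightarrow> transpose A = A \<and> (\<forall>x. x \<noteq> 0 \<longrightarrow> 0 < x \<bullet> (A *v x))"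

text \<open>Only square matrices are needed below. The set of singular values (without multiplicity)
  is then finite and nonempty, so that \<^term>\<open>Max\<close> and \<^term>\<open>Min\<close> apply.\<close>

definition singular_values :: "real ^ 'n ^ 'n \<Rightarrow> real set" where
  "singular_values A = {sqrt e | e. \<exists>v. v \<noteq> 0 \<and> (transpose A ** A) *v v = e *\<^sub>R v}"

definition sigma_max :: "real ^ 'n ^ 'n \<Rightarrow> real" where
  "sigma_max A = Max (singular_values A)"

definition sigma_min :: "real ^ 'n ^ 'n \<Rightarrow> real" where
  "sigma_min A = Min (singular_values A)"

text \<open>A block diagonal matrix with one block per element of \<^typ>\<open>'s\<close>: rows and columns are
  indexed by pairs (block, index within the block).\<close>

definition block_diag :: "('s::finite \<Rightarrow> real ^ 'n ^ 'n) \<Rightarrow> real ^ ('s \<times> 'n) ^ ('s \<times> 'n)" where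
  "block_diag X = (\<chi> p q. if fst p = fst q then X (fst p) $ snd p $ snd q else 0)"


section \<open>Markovian jump linear systems\<close>

text \<open>The conditional probabilities given the whole history express both the Markov property and
  time homogeneity.\<close>

definition markov_chain ::
  "'w measure \<Rightarrow> ('s \<Rightarrow> 's \<Rightarrow> real) \<Rightarrow> ('s \<Rightarrow> real) \<Rightarrow> (nat \<Rightarrow> 'w \<Rightarrow> 's::finite) \<Rightarrow> bool" where
  "markov_chain M p \<pi> \<omega> \<longleftrightarrow>
     (\<forall>t. \<omega> t \<in> M \<rightarrow>\<^sub>M count_space UNIV) \<and>
     (\<forall>i j. 0 \<le> p i j) \<and> (\<forall>i. (\<Sum>j\<in>UNIV. p i j) = 1) \<and>
     (\<forall>i. \<P>(w in M. \<omega> 0 w = i) = \<pi> i) \<and>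
     (\<forall>t h j. \<P>(w in M. \<forall>s\<le>t. \<omega> s w = h s) \<noteq> 0 \<longrightarrow>
        \<P>(w in M. \<omega> (Suc t) w = j \<bar> \<forall>s\<le>t. \<omega> s w = h s) = p (h t) j)"

definition control :: "('s \<Rightarrow> real ^ 'd ^ 'k) \<Rightarrow> 's \<Rightarrow> real ^ 'd \<Rightarrow> real ^ 'k" where
  "control K i x = - (K i *v x)"

primrec state ::
  "('s \<Rightarrow> real ^ 'd ^ 'd) \<Rightarrow> ('s \<Rightarrow> real ^ 'k ^ 'd) \<Rightarrow> ('s \<Rightarrow> real ^ 'd ^ 'k) \<Rightarrow>
   (nat \<Rightarrow> 'w \<Rightarrow> 's) \<Rightarrow> ('w \<Rightarrow> real ^ 'd) \<Rightarrow> nat \<Rightarrow> 'w \<Rightarrow> real ^ 'd" where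
  "state A B K \<omega> x0 0 w = x0 w"
| "state A B K \<omega> x0 (Suc t) w =
     A (\<omega> t w) *v state A B K \<omega> x0 t w
     + B (\<omega> t w) *v control K (\<omega> t w) (state A B K \<omega> x0 t w)"

text \<open>The expected total cost, possibly infinite. The summands are nonnegative when all weights are
  positive definite, so \<^const>\<open>ennreal\<close> then loses no information.\<close>

definition cost ::
  "'w measure \<Rightarrow> ('s \<Rightarrow> real ^ 'd ^ 'd) \<Rightarrow> ('s \<Rightarrow> real ^ 'k ^ 'd) \<Rightarrow>
   ('s \<Rightarrow> real ^ 'd ^ 'd) \<Rightarrow> ('s \<Rightarrow> real ^ 'k ^ 'k) \<Rightarrow>
   (nat \<Rightarrow> 'w \<Rightarrow> 's) \<Rightarrow> ('w \<Rightarrow> real ^ 'd) \<Rightarrow> ('s \<Rightarrow> real ^ 'd ^ 'k) \<Rightarrow> ennreal" where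
  "cost M A B Q R \<omega> x0 K =
     (\<integral>\<^sup>+ w. (\<Sum>t. ennreal
        (let i = \<omega> t w; x = state A B K \<omega> x0 t w; u = control K i x
         in x \<bullet> (Q i *v x) + u \<bullet> (R i *v u))) \<partial>M)"

text \<open>The second moment of the state tends to 0 from every deterministic initial state \<open>\<xi>\<close> and every
  initial mode \<open>i\<close>. The chain is started in \<open>i\<close> by conditioning on \<open>\<omega> 0 = i\<close>,
  which presupposes that this event has positive probability.\<close>

definition mean_square_stabilizable ::
  "'w measure \<Rightarrow> ('s \<Rightarrow> real ^ 'd ^ 'd) \<Rightarrow> ('s \<Rightarrow> real ^ 'k ^ 'd) \<Rightarrow> (nat \<Rightarrow> 'w \<Rightarrow> 's) \<Rightarrow> bool" where
  "mean_square_stabilizable M A B \<omega> \<longleftrightarrow>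
     (\<exists>K :: 's \<Rightarrow> real ^ 'd ^ 'k. \<forall>\<xi> i.
        (\<lambda>t. \<integral>w. (norm (state A B K \<omega> (\<lambda>_. \<xi>) t w))\<^sup>2
               \<partial>uniform_measure M {w \<in> space M. \<omega> 0 w = i}) \<longlonglongrightarrow> 0)"

definition mode_cov ::
  "'w measure \<Rightarrow> ('s \<Rightarrow> real ^ 'd ^ 'd) \<Rightarrow> ('s \<Rightarrow> real ^ 'k ^ 'd) \<Rightarrow> (nat \<Rightarrow> 'w \<Rightarrow> 's) \<Rightarrow>
   ('w \<Rightarrow> real ^ 'd) \<Rightarrow> ('s \<Rightarrow> real ^ 'd ^ 'k) \<Rightarrow> 's \<Rightarrow> nat \<Rightarrow> real ^ 'd ^ 'd" where
  "mode_cov M A B \<omega> x0 K i t =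
     (\<integral>w. indicator {w. \<omega> t w = i} w *\<^sub>R
           outer (state A B K \<omega> x0 t w) (state A B K \<omega> x0 t w) \<partial>M)"

definition chi_upto ::
  "'w measure \<Rightarrow> ('s::finite \<Rightarrow> real ^ 'd ^ 'd) \<Rightarrow> ('s \<Rightarrow> real ^ 'k ^ 'd) \<Rightarrow> (nat \<Rightarrow> 'w \<Rightarrow> 's) \<Rightarrow>
   ('w \<Rightarrow> real ^ 'd) \<Rightarrow> ('s \<Rightarrow> real ^ 'd ^ 'k) \<Rightarrow> nat \<Rightarrow> real ^ ('s \<times> 'd) ^ ('s \<times> 'd)" where
  "chi_upto M A B \<omega> x0 K l = block_diag (\<lambda>i. \<Sum>t=0..l. mode_cov M A B \<omega> x0 K i t)"

text \<open>The series converges whenever the weights are positive definite and the cost is finite.\<close>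

definition chi ::
  "'w measure \<Rightarrow> ('s::finite \<Rightarrow> real ^ 'd ^ 'd) \<Rightarrow> ('s \<Rightarrow> real ^ 'k ^ 'd) \<Rightarrow> (nat \<Rightarrow> 'w \<Rightarrow> 's) \<Rightarrow>
   ('w \<Rightarrow> real ^ 'd) \<Rightarrow> ('s \<Rightarrow> real ^ 'd ^ 'k) \<Rightarrow> real ^ ('s \<times> 'd) ^ ('s \<times> 'd)" where
  "chi M A B \<omega> x0 K = block_diag (\<lambda>i. \<Sum>t. mode_cov M A B \<omega> x0 K i t)"

definition second_moment :: "(real ^ 'd) measure \<Rightarrow> real ^ 'd ^ 'd" where
  "second_moment D = (\<integral>x. outer x x \<partial>D)"

definition mu :: "('s::finite \<Rightarrow> real) \<Rightarrow> (real ^ 'd) measure \<Rightarrow> real" where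
  "mu \<pi> D = Min (range \<pi>) * sigma_min (second_moment D)"

definition Lambda_min :: "('s::finite \<Rightarrow> real ^ 'd ^ 'd) \<Rightarrow> real" where
  "Lambda_min Q = Min (range (\<lambda>i. sigma_min (Q i)))"

end

theory Submission
  imports Defs
begin

text \<open>
  Let \<open>g t\<close> be the second moment of the state at time \<open>t\<close> and \<open>S\<close> the sum of all \<open>g t\<close>, so that
  \<open>\<Lambda>\<^sub>m\<^sub>i\<^sub>n(Q) S \<le> C(K)\<close>. By the Markov property \<open>g (t + n)\<close> is the expectation of a nonnegative quadratic
  form \<open>V\<^sub>n\<close>, depending on the mode, in the state at time \<open>t\<close>. With \<open>c\<close> the sum over the modes of the
  traces of \<open>V\<^sub>n\<close>, we get \<open>g (t + n) \<le> c g t\<close>, while \<open>g n \<ge> \<mu> c\<close> because the initial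
  mode and the initial state are independent. Hence \<open>\<mu> g (t + n) \<le> g t g n\<close>. Summing over all \<open>n\<close>, and
  then over \<open>t \<le> l\<close>, bounds \<open>(l + 1) \<mu>\<close> times the tail of the series after \<open>l\<close> by \<open>S\<^sup>2\<close>. Finally, the
  Frobenius norm of \<open>x x\<^sup>T\<close> is \<open>|x|\<^sup>2\<close>, so this tail dominates the Frobenius norm of the truncation
  error, and thereby its largest singular value.
\<close>

section \<open>Matrices\<close>

lemma norm_vec_squared: "(norm (x :: 'a :: real_normed_vector ^ 'n))\<^sup>2 = (\<Sum>i\<in>UNIV. (norm (x $ i))\<^sup>2)"
  by (simp add: norm_vec_def L2_set_def sum_nonneg)

text \<open>On this type \<open>norm A\<close> is the Frobenius norm; Cauchy-Schwarz is applied to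
  each row of \<open>A\<close>.\<close>

lemma norm_matrix_vector_mult_le:
  fixes A :: "real ^ 'n ^ 'm"
  shows "norm (A *v x) \<le> norm A * norm x"
proof (rule power2_le_imp_le)
  have "(norm (A *v x))\<^sup>2 = (\<Sum>i\<in>UNIV. (A $ i \<bullet> x)\<^sup>2)"
    by (simp add: norm_vec_squared[of "A *v x"] matrix_vector_mul_component)
  also have "\<dots> \<le> (\<Sum>i\<in>UNIV. (norm (A $ i))\<^sup>2 * (norm x)\<^sup>2)"
    by (intro sum_mono) (metis Cauchy_Schwarz_ineq dot_square_norm)
  also have "\<dots> = (norm A * norm x)\<^sup>2"
    by (simp add: norm_vec_squared[of A] power_mult_distrib sum_distrib_right)
  finally show "(norm (A *v x))\<^sup>2 \<le> (norm A * norm x)\<^sup>2" .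
qed simp

lemma norm_squared_eq_sum_columns:
  fixes A :: "real ^ 'n ^ 'm"
  shows "(norm A)\<^sup>2 = (\<Sum>k\<in>UNIV. (norm (A *v axis k 1))\<^sup>2)"
proof -
  have "(norm A)\<^sup>2 = (\<Sum>i\<in>UNIV. \<Sum>k\<in>UNIV. (A $ i $ k)\<^sup>2)"
    by (simp add: norm_vec_squared)
  also have "\<dots> = (\<Sum>k\<in>UNIV. (norm (A *v axis k 1))\<^sup>2)"
    by (subst sum.swap) (simp add: norm_vec_squared matrix_vector_mult_basis column_def)
  finally show ?thesis .
qed

lemma norm_outer_self: "norm (outer x x) = (norm x)\<^sup>2"
proof -
  have "(norm (outer x x))\<^sup>2 = (\<Sum>i\<in>UNIV. \<Sum>j\<in>UNIV. (x $ i)\<^sup>2 * (x $ j)\<^sup>2)"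
    by (simp add: norm_vec_squared[of "outer x x"] norm_vec_squared outer_def power_mult_distrib)
  also have "\<dots> = ((norm x)\<^sup>2)\<^sup>2"
    by (simp add: norm_vec_squared[of x] power2_eq_square[of "sum _ _"] sum_product)
  finally show ?thesis
    by (metis norm_ge_zero power2_eq_iff_nonneg zero_le_power2)
qed

lemma inner_outer_mult: "v \<bullet> (outer x x *v v) = (v \<bullet> x)\<^sup>2"
  by (simp add: inner_vec_def outer_def matrix_vector_mult_def power2_eq_square sum_product
      sum_distrib_left mult_ac)

text \<open>This is what moves a quadratic form inside the Bochner integral defining
  \<open>second_moment\<close>.\<close>

lemma bounded_linear_inner_mult: "bounded_linear (\<lambda>A :: real ^ 'n ^ 'm. v \<bullet> (A *v w))"
  unfolding bounded_linear_inner_right linear_conv_bounded_linear[symmetric]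
  by (rule linearI) (simp_all add: matrix_vector_mult_add_rdistrib inner_add_right
      scaleR_matrix_vector_assoc[symmetric])

section \<open>Eigenvalues of symmetric matrices and singular values\<close>

lemma gram_inner:
  fixes A :: "real ^ 'n ^ 'm"
  shows "v \<bullet> ((transpose A ** A) *v w) = (A *v v) \<bullet> (A *v w)"
  by (metis dot_lmul_matrix matrix_vector_mul_assoc vector_transpose_matrix)

lemma symmetric_gram: "transpose (transpose A ** A) = transpose A ** (A :: real ^ 'n ^ 'm)"
  by (simp add: matrix_transpose_mul)

lemma inner_symmetric_matrix:
  fixes S :: "real ^ 'n ^ 'n"
  assumes "transpose S = S"
  shows "v \<bullet> (S *v w) = (S *v v) \<bullet> w"
  by (metis assms dot_lmul_matrix transpose_matrix_vector)

text \<open>The Rayleigh quotient attains its minimum on the compact unit sphere, and a minimiser is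
  an eigenvector because the residual \<open>z = S *v v - e *\<^sub>R v\<close> must vanish.\<close>

lemma symmetric_matrix_least_eigenvalue:
  fixes S :: "real ^ 'n ^ 'n"
  assumes S: "transpose S = S"
  shows "\<exists>e v. v \<noteq> 0 \<and> S *v v = e *\<^sub>R v \<and> (\<forall>x. e * (norm x)\<^sup>2 \<le> x \<bullet> (S *v x))"
proof -
  let ?q = "\<lambda>x. x \<bullet> (S *v x)"
  have "continuous_on (sphere 0 1) ?q"
    by (intro continuous_intros matrix_vector_mult_linear_continuous_on)
  moreover have "sphere (0 :: real ^ 'n) 1 \<noteq> {}"
    using norm_axis_1 by fastforce
  ultimately obtain v where v: "norm v = 1" and min: "\<And>x. norm x = 1 \<Longrightarrow> ?q v \<le> ?q x"
    using continuous_attains_inf[of "sphere 0 1" ?q] by (auto simp: dist_norm)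
  define e where "e = ?q v"
  have bound: "e * (norm x)\<^sup>2 \<le> ?q x" for x
  proof (cases "x = 0")
    case False
    have "e \<le> ?q (x /\<^sub>R norm x)"
      unfolding e_def using False by (intro min) simp
    also have "\<dots> = ?q x / (norm x)\<^sup>2"
      by (simp add: matrix_vector_mult_scaleR power2_eq_square divide_simps)
    finally show ?thesis
      using False by (simp add: field_simps)
  qed simp
  define z where "z = S *v v - e *\<^sub>R v"
  have vz: "v \<bullet> z = 0"
    using v by (simp add: z_def e_def inner_diff_right dot_square_norm)
  \<comment> \<open>the form \<open>x \<bullet> S x - e |x|\<^sup>2\<close> is minimal at \<open>v\<close>, so its first variation along \<open>z\<close> vanishes\<close>
  have quad: "0 \<le> 2 * t * (norm z)\<^sup>2 + t\<^sup>2 * (?q z - e * (norm z)\<^sup>2)" for t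
  proof -
    have "v \<bullet> (S *v z) = (norm z)\<^sup>2"
    proof -
      have "S *v v = z + e *\<^sub>R v" by (simp add: z_def)
      then show ?thesis
        by (simp add: inner_symmetric_matrix[OF S] inner_add_left vz dot_square_norm)
    qed
    moreover have "z \<bullet> (S *v v) = v \<bullet> (S *v z)"
      by (metis S inner_commute inner_symmetric_matrix)
    moreover have "(norm (v + t *\<^sub>R z))\<^sup>2 = 1 + t\<^sup>2 * (norm z)\<^sup>2"
      using v vz unfolding power2_norm_eq_inner norm_eq_1
      by (simp add: inner_add_left inner_add_right inner_commute power2_eq_square)
    ultimately show ?thesis
      using bound[of "v + t *\<^sub>R z"]
      by (simp add: matrix_vector_right_distrib matrix_vector_mult_scaleR inner_add_left
          inner_add_right e_def[symmetric] algebra_simps power2_eq_square)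
  qed
  have "z = 0"
  proof (rule ccontr)
    assume "z \<noteq> 0"
    define b where "b = ?q z - e * (norm z)\<^sup>2"
    have b: "0 \<le> b" using bound[of z] by (simp add: b_def)
    \<comment> \<open>A small negative step makes the linear term win. Dividing by
      \<open>b + 1\<close> instead of \<open>b\<close> covers \<open>b = 0\<close>.\<close>
    define t where "t = - (norm z)\<^sup>2 / (b + 1)"
    have t: "t * b = - (norm z)\<^sup>2 - t"
      using b by (simp add: t_def field_simps)
    have "2 * t * (norm z)\<^sup>2 + t\<^sup>2 * b = t * (2 * (norm z)\<^sup>2 + t * b)"
      by (simp add: power2_eq_square algebra_simps)
    also have "\<dots> = t * ((norm z)\<^sup>2 - t)"
      by (simp add: t)
    also have "\<dots> < 0"
      using b \<open>z \<noteq> 0\<close> by (intro mult_neg_pos) (auto simp: t_def divide_neg_pos add_pos_nonneg)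
    finally show False
      using quad[of t] by (simp add: b_def)
  qed
  then have "S *v v = e *\<^sub>R v" by (simp add: z_def)
  moreover have "v \<noteq> 0" using v by auto
  ultimately show ?thesis
    using bound by (intro exI[of _ e] exI[of _ v] conjI allI)
qed

text \<open>Nonzero orthogonal vectors are linearly independent, and orthogonality also forces
  \<open>f\<close> to be injective on \<open>E\<close>.\<close>

lemma finite_orthogonal_family:
  fixes f :: "'a \<Rightarrow> 'b :: euclidean_space"
  assumes nz: "\<And>a. a \<in> E \<Longrightarrow> f a \<noteq> 0"
    and orth: "\<And>a b. a \<in> E \<Longrightarrow> b \<in> E \<Longrightarrow> a \<noteq> b \<Longrightarrow> f a \<bullet> f b = 0"
  shows "finite E"
proof (rule finite_imageD)
  show "inj_on f E"
    using orth nz by (intro inj_onI) (metis inner_eq_zero_iff)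
  have "pairwise orthogonal (f ` E)"
    using orth unfolding pairwise_def orthogonal_def by blast
  moreover have "0 \<notin> f ` E"
    using nz by auto
  ultimately show "finite (f ` E)"
    by (intro independent_imp_finite pairwise_orthogonal_independent)
qed

text \<open>One eigenvector is chosen for each eigenvalue; symmetry makes those of distinct
  eigenvalues orthogonal.\<close>

lemma finite_eigenvalues_symmetric:
  fixes S :: "real ^ 'n ^ 'n"
  assumes S: "transpose S = S"
  shows "finite {e. \<exists>v. v \<noteq> 0 \<and> S *v v = e *\<^sub>R v}" (is "finite ?E")
proof -
  have "\<forall>e\<in>?E. \<exists>v. v \<noteq> 0 \<and> S *v v = e *\<^sub>R v" by simp
  from bchoice[OF this] obtain f where f: "\<forall>e\<in>?E. f e \<noteq> 0 \<and> S *v f e = e *\<^sub>R f e" ..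
  have nz: "f e \<noteq> 0" and eig: "S *v f e = e *\<^sub>R f e" if "e \<in> ?E" for e
    by (rule conjunct1[OF bspec[OF f that]], rule conjunct2[OF bspec[OF f that]])
  have orth: "f a \<bullet> f b = 0" if "a \<in> ?E" "b \<in> ?E" "a \<noteq> b" for a b
  proof -
    have "b * (f a \<bullet> f b) = a * (f a \<bullet> f b)"
      using inner_symmetric_matrix[OF S, of "f a" "f b"] by (simp only: eig that inner_scaleR_left inner_scaleR_right)
    with that(3) show ?thesis by (simp only: mult_cancel_right) auto
  qed
  show ?thesis
    using nz orth by (rule finite_orthogonal_family)
qed

lemma finite_singular_values: "finite (singular_values A)"
proof -
  have "singular_values A = sqrt ` {e. \<exists>v. v \<noteq> 0 \<and> (transpose A ** A) *v v = e *\<^sub>R v}"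
    by (auto simp: singular_values_def)
  then show ?thesis
    by (simp add: finite_eigenvalues_symmetric symmetric_gram)
qed

lemma singular_values_nonempty: "singular_values A \<noteq> {}"
proof -
  obtain e v where "v \<noteq> 0" "(transpose A ** A) *v v = e *\<^sub>R v"
    using symmetric_matrix_least_eigenvalue[OF symmetric_gram[of A]] by blast
  then have "sqrt e \<in> singular_values A"
    by (auto simp: singular_values_def)
  then show ?thesis by blast
qed

text \<open>Pairing the eigenvector equation of the Gram matrix with \<open>v\<close> gives
  \<open>(norm (A *v v))\<^sup>2 = e * (norm v)\<^sup>2\<close>. All later facts on individual
  singular values go through this ratio.\<close>

lemma singular_value_eq_norm_ratio:
  assumes "s \<in> singular_values A"
  obtains v where "v \<noteq> 0" "norm (A *v v) = s * norm v"
proof -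
  from assms obtain e v where s: "s = sqrt e" and "v \<noteq> 0" and v: "(transpose A ** A) *v v = e *\<^sub>R v"
    by (auto simp: singular_values_def)
  have "(norm (A *v v))\<^sup>2 = e * (norm v)\<^sup>2"
    using gram_inner[of v A v] v by (simp add: dot_square_norm)
  then have "norm (A *v v) = s * norm v"
    by (metis norm_ge_zero real_sqrt_abs2 real_sqrt_mult abs_of_nonneg power2_eq_square s)
  with \<open>v \<noteq> 0\<close> show thesis by (rule that)
qed

lemma sigma_max_le_norm: "sigma_max A \<le> norm A"
proof -
  have "s \<le> norm A" if s: "s \<in> singular_values A" for s
  proof -
    obtain v where v: "v \<noteq> 0" "norm (A *v v) = s * norm v"
      using singular_value_eq_norm_ratio[OF s] .
    then show ?thesis
      using norm_matrix_vector_mult_le[of A v] by simp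
  qed
  then show ?thesis
    unfolding sigma_max_def by (intro Max.boundedI finite_singular_values singular_values_nonempty)
qed

lemma sigma_min_pos:
  assumes "posdef S"
  shows "0 < sigma_min S"
proof -
  have "0 < s" if s: "s \<in> singular_values S" for s
  proof -
    obtain v where v: "v \<noteq> 0" "norm (S *v v) = s * norm v"
      using singular_value_eq_norm_ratio[OF s] .
    have "S *v v \<noteq> 0"
      using assms v(1) by (metis inner_zero_right less_irrefl posdef_def)
    then show ?thesis
      using v by (metis norm_ge_zero zero_less_mult_pos2 zero_less_norm_iff)
  qed
  then show ?thesis
    using Min_in[OF finite_singular_values singular_values_nonempty] by (metis sigma_min_def)
qed

text \<open>The least eigenvalue \<open>e\<close> of \<open>S\<close> bounds the form from below. It
  is positive and its square is an eigenvalue of the Gram matrix, so \<open>e\<close> is itself a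
  singular value and \<open>sigma_min S\<close> cannot exceed it.\<close>

lemma sigma_min_le_form:
  assumes S: "posdef S"
  shows "sigma_min S * (norm x)\<^sup>2 \<le> x \<bullet> (S *v x)"
proof -
  have sym: "transpose S = S" using S by (simp add: posdef_def)
  obtain e v where "v \<noteq> 0 \<and> S *v v = e *\<^sub>R v \<and> (\<forall>x. e * (norm x)\<^sup>2 \<le> x \<bullet> (S *v x))"
    using symmetric_matrix_least_eigenvalue[OF sym] by (elim exE)
  then have v: "v \<noteq> 0" "S *v v = e *\<^sub>R v" and bound: "\<And>x. e * (norm x)\<^sup>2 \<le> x \<bullet> (S *v x)"
    by simp_all
  have "0 < e * (norm v)\<^sup>2"
    using S v by (auto simp: posdef_def dot_square_norm)
  then have "0 < e" using v by (simp add: zero_less_mult_iff)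
  moreover have "(transpose S ** S) *v v = e\<^sup>2 *\<^sub>R v"
    by (simp add: sym matrix_vector_mul_assoc[symmetric] v matrix_vector_mult_scaleR power2_eq_square)
  ultimately have "e \<in> singular_values S"
    using v(1) unfolding singular_values_def by (auto intro!: exI[of _ "e\<^sup>2"])
  then have "sigma_min S \<le> e"
    unfolding sigma_min_def by (intro Min_le finite_singular_values)
  then have "sigma_min S * (norm x)\<^sup>2 \<le> e * (norm x)\<^sup>2"
    by (intro mult_right_mono) auto
  with bound[of x] show ?thesis by simp
qed

text \<open>The Frobenius norm of a block diagonal matrix is the Euclidean norm of the list of block
  norms, which is at most their sum.\<close>

lemma norm_block_diag_le: "norm (block_diag X) \<le> (\<Sum>i\<in>UNIV. norm (X i))"
proof -
  have "(norm (block_diag X))\<^sup>2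
      = (\<Sum>p\<in>UNIV \<times> UNIV. \<Sum>q\<in>UNIV \<times> UNIV. if fst p = fst q then (X (fst p) $ snd p $ snd q)\<^sup>2 else 0)"
    by (simp add: norm_vec_squared[of "block_diag X"] norm_vec_squared block_diag_def)
      (intro sum.cong refl; simp)
  also have "\<dots> = (\<Sum>i\<in>UNIV. \<Sum>a\<in>UNIV. \<Sum>j\<in>UNIV. \<Sum>b\<in>UNIV. if i = j then (X i $ a $ b)\<^sup>2 else 0)"
    unfolding sum.cartesian_product' fst_conv snd_conv ..
  \<comment> \<open>With the sum over \<open>j\<close> innermost, the condition \<open>i = j\<close>
    leaves a single term.\<close>
  also have "\<dots> = (\<Sum>i\<in>UNIV. \<Sum>a\<in>UNIV. \<Sum>b\<in>UNIV. \<Sum>j\<in>UNIV. if i = j then (X i $ a $ b)\<^sup>2 else 0)"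
    by (intro sum.cong refl sum.swap)
  also have "\<dots> = (\<Sum>i\<in>UNIV. (norm (X i))\<^sup>2)"
    by (simp add: norm_vec_squared)
  finally have "norm (block_diag X) = L2_set (\<lambda>i. norm (X i)) UNIV"
    by (simp add: L2_set_def real_sqrt_unique)
  then show ?thesis
    by (simp add: L2_set_le_sum)
qed

lemma block_diag_diff: "block_diag X - block_diag Y = block_diag (\<lambda>i. X i - Y i)"
  by (simp add: block_diag_def vec_eq_iff)

section \<open>Expectations along the chain\<close>

text \<open>Independence is stated for the generated sigma-algebras, since the initial state and the
  whole mode path take values in different types.\<close>

locale jump_linear_system = prob_space M
  for M :: "'w measure" +
  fixes \<omega> :: "nat \<Rightarrow> 'w \<Rightarrow> 's::finite"
    and p :: "'s \<Rightarrow> 's \<Rightarrow> real" and \<pi> :: "'s \<Rightarrow> real"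
    and x0 :: "'w \<Rightarrow> real ^ 'd"
    and A :: "'s \<Rightarrow> real ^ 'd ^ 'd" and B :: "'s \<Rightarrow> real ^ 'k ^ 'd"
    and K :: "'s \<Rightarrow> real ^ 'd ^ 'k"
  assumes chain: "markov_chain M p \<pi> \<omega>"
    and x0_measurable [measurable]: "x0 \<in> borel_measurable M"
    and indep: "indep_set (sets (vimage_algebra (space M) x0 borel))
      (sets (vimage_algebra (space M) (\<lambda>w t. \<omega> t w) (\<Pi>\<^sub>M t\<in>UNIV. count_space UNIV)))"
begin

abbreviation x :: "nat \<Rightarrow> 'w \<Rightarrow> real ^ 'd" where
  "x \<equiv> state A B K \<omega> x0"

definition closed_loop :: "'s \<Rightarrow> real ^ 'd ^ 'd" where
  "closed_loop i = A i - B i ** K i"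

lemma x_Suc: "x (Suc t) w = closed_loop (\<omega> t w) *v x t w"
  by (simp add: closed_loop_def control_def matrix_vector_mult_diff_rdistrib
      matrix_vector_mul_assoc[symmetric] linear_neg[OF matrix_vector_mul_linear])

declare state.simps(2) [simp del]

lemma mode_measurable [measurable]: "\<omega> t \<in> M \<rightarrow>\<^sub>M count_space UNIV"
  using chain by (simp add: markov_chain_def)

lemma p_nonneg: "0 \<le> p i j"
  using chain by (simp add: markov_chain_def)

lemma closed_loop_measurable [measurable]: "(\<lambda>v. closed_loop i *v v) \<in> borel_measurable borel"
  by (intro borel_measurable_continuous_onI matrix_vector_mult_linear_continuous_on)

lemma x_measurable [measurable]: "x t \<in> borel_measurable M"
proof (induction t)
  case (Suc t)
  note [measurable] = Suc
  have "(\<lambda>w. closed_loop (\<omega> t w) *v x t w) \<in> borel_measurable M"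
    by (rule measurable_compose_countable[where f = "\<lambda>i w. closed_loop i *v x t w"]) measurable
  then show ?case
    by (simp add: x_Suc[abs_def])
qed (simp add: x0_measurable[unfolded state.simps])

section \<open>Cylinder events of the chain, independence and the Markov property\<close>

definition history :: "nat \<Rightarrow> (nat \<Rightarrow> 's) \<Rightarrow> 'w set" where
  "history t h = {w \<in> space M. \<forall>s\<le>t. \<omega> s w = h s}"

lemma history_measurable [measurable]: "history t h \<in> events"
  unfolding history_def by measurable

text \<open>The product of the closed-loop matrices along the modes \<open>h 0\<close>, ...,
  \<open>h (t - 1)\<close>, newest on the left. Once the modes are fixed, the state is this
  deterministic linear image of \<open>x0\<close>.\<close>

primrec transition :: "(nat \<Rightarrow> 's) \<Rightarrow> nat \<Rightarrow> real ^ 'd ^ 'd" where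
  "transition h 0 = mat 1"
| "transition h (Suc t) = closed_loop (h t) ** transition h t"

lemma x_on_history:
  assumes "w \<in> history t h"
  shows "x t w = transition h t *v x0 w"
proof -
  have "s \<le> t \<Longrightarrow> x s w = transition h s *v x0 w" for s
    using assms
    by (induction s) (auto simp: history_def x_Suc matrix_vector_mul_assoc)
  then show ?thesis by simp
qed

text \<open>The two factors are functions of the initial state and of the mode path, so they inherit
  independence from the two generated sigma-algebras and the integral factorises.\<close>

lemma nn_integral_indep:
  fixes f :: "real ^ 'd \<Rightarrow> ennreal"
  assumes f[measurable]: "f \<in> borel_measurable borel"
    and E: "E \<in> sets (\<Pi>\<^sub>M t\<in>UNIV. count_space UNIV)"
  shows "(\<integral>\<^sup>+w. f (x0 w) * indicator E (\<lambda>t. \<omega> t w) \<partial>M)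
    = (\<integral>\<^sup>+w. f (x0 w) \<partial>M) * emeasure M {w \<in> space M. (\<lambda>t. \<omega> t w) \<in> E}"
proof -
  let ?P = "\<Pi>\<^sub>M t\<in>UNIV. count_space (UNIV :: 's set)"
  have meas: "(\<lambda>w t. \<omega> t w) \<in> M \<rightarrow>\<^sub>M ?P"
    by (rule measurable_PiM_single') (auto simp: space_PiM)
  note [measurable] = meas E
  \<comment> \<open>A function measurable with respect to the sigma-algebra generated by
    \<open>Y\<close> generates a smaller one.\<close>
  have sub: "sigma_sets (space M) {g -` S \<inter> space M | S. S \<in> sets borel} \<subseteq> sets (vimage_algebra (space M) Y N)"
    if "g \<in> vimage_algebra (space M) Y N \<rightarrow>\<^sub>M borel" for g :: "'w \<Rightarrow> ennreal" and Y :: "'w \<Rightarrow> 'b" and N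
    using sets.sigma_sets_subset[of "{g -` S \<inter> space M | S. S \<in> sets borel}" "vimage_algebra (space M) Y N"]
      measurable_sets[OF that] by auto
  have "(\<lambda>w. f (x0 w)) \<in> vimage_algebra (space M) x0 borel \<rightarrow>\<^sub>M borel"
    by (rule measurable_compose[OF measurable_vimage_algebra1 f]) auto
  moreover have "(\<lambda>w. indicator E (\<lambda>t. \<omega> t w)) \<in> vimage_algebra (space M) (\<lambda>w t. \<omega> t w) ?P \<rightarrow>\<^sub>M borel"
    by (rule measurable_compose[OF measurable_vimage_algebra1]) (auto simp: space_PiM)
  ultimately have "indep_set
      (sigma_sets (space M) {(\<lambda>w. f (x0 w)) -` S \<inter> space M | S. S \<in> sets borel})
      (sigma_sets (space M) {(\<lambda>w. indicator E (\<lambda>t. \<omega> t w) :: ennreal) -` S \<inter> space M | S. S \<in> sets borel})"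
    using indep unfolding indep_set_def
    by (elim indep_sets_mono_sets) (auto split: bool.split dest!: sub)
  then have "indep_var borel (\<lambda>w. f (x0 w)) borel (\<lambda>w. indicator E (\<lambda>t. \<omega> t w) :: ennreal)"
    by (simp add: indep_var_eq)
  then have "indep_vars (\<lambda>_. borel) (case_bool (\<lambda>w. f (x0 w)) (\<lambda>w. indicator E (\<lambda>t. \<omega> t w))) UNIV"
    unfolding indep_var_def by (rule indep_vars_cong[THEN iffD1, rotated -1]) (auto split: bool.split)
  from indep_vars_nn_integral[OF finite this]
  have "(\<integral>\<^sup>+w. f (x0 w) * indicator E (\<lambda>t. \<omega> t w) \<partial>M)
      = (\<integral>\<^sup>+w. f (x0 w) \<partial>M) * (\<integral>\<^sup>+w. indicator E (\<lambda>t. \<omega> t w) \<partial>M)"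
    by (simp add: UNIV_bool mult.commute)
  also have "(\<integral>\<^sup>+w. indicator E (\<lambda>t. \<omega> t w) \<partial>M)
      = (\<integral>\<^sup>+w. indicator {w \<in> space M. (\<lambda>t. \<omega> t w) \<in> E} w \<partial>M)"
    by (rule nn_integral_cong) (auto simp: indicator_def)
  also have "\<dots> = emeasure M {w \<in> space M. (\<lambda>t. \<omega> t w) \<in> E}"
    by (rule nn_integral_indicator) measurable
  finally show ?thesis .
qed

lemma nn_integral_on_history:
  fixes f :: "real ^ 'd \<Rightarrow> ennreal"
  assumes [measurable]: "f \<in> borel_measurable borel"
  shows "(\<integral>\<^sup>+w. f (x0 w) * indicator (history t h) w \<partial>M)
    = (\<integral>\<^sup>+w. f (x0 w) \<partial>M) * emeasure M (history t h)"
proof -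
  define E where "E = {g \<in> space (\<Pi>\<^sub>M t\<in>UNIV. count_space (UNIV :: 's set)). \<forall>s\<le>t. g s = h s}"
  have E: "E \<in> sets (\<Pi>\<^sub>M t\<in>UNIV. count_space UNIV)"
    unfolding E_def by measurable
  have eq: "{w \<in> space M. (\<lambda>t. \<omega> t w) \<in> E} = history t h"
    by (auto simp: E_def history_def space_PiM)
  have "(\<integral>\<^sup>+w. f (x0 w) * indicator (history t h) w \<partial>M)
      = (\<integral>\<^sup>+w. f (x0 w) * indicator E (\<lambda>t. \<omega> t w) \<partial>M)"
    by (intro nn_integral_cong) (auto simp: indicator_def eq[symmetric])
  then show ?thesis
    by (simp add: nn_integral_indep[OF _ E] eq)
qed

text \<open>For a history of positive probability this is the Markov property. For a null history
  the conditional probability says nothing, but by monotonicity both sides are 0.\<close>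

lemma emeasure_history_Suc:
  "emeasure M (history (Suc t) h) = emeasure M (history t h) * p (h t) (h (Suc t))"
proof -
  have eq: "history (Suc t) h = {w \<in> space M. \<omega> (Suc t) w = h (Suc t) \<and> (\<forall>s\<le>t. \<omega> s w = h s)}"
    by (auto simp: history_def le_Suc_eq)
  show ?thesis
  proof (cases "prob (history t h) = 0")
    case True
    moreover have "prob (history (Suc t) h) \<le> prob (history t h)"
      by (rule finite_measure_mono) (auto simp: history_def history_measurable[unfolded history_def])
    ultimately show ?thesis
      by (simp add: emeasure_eq_measure measure_le_0_iff)
  next
    case False
    then have "cond_prob M (\<lambda>w. \<omega> (Suc t) w = h (Suc t)) (\<lambda>w. \<forall>s\<le>t. \<omega> s w = h s) = p (h t) (h (Suc t))"
      using chain unfolding markov_chain_def history_def by blast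
    then have "prob (history (Suc t) h) / prob (history t h) = p (h t) (h (Suc t))"
      unfolding eq by (simp add: cond_prob_def history_def)
    with False show ?thesis
      by (simp add: emeasure_eq_measure ennreal_mult'[symmetric] p_nonneg field_simps)
  qed
qed

text \<open>The histories up to \<open>t\<close> partition the space. Indexing them by extensional
  functions keeps the sum finite and counts each path once.\<close>

lemma nn_integral_split_history:
  fixes f :: "'w \<Rightarrow> ennreal"
  assumes [measurable]: "f \<in> borel_measurable M"
  shows "(\<integral>\<^sup>+w. f w \<partial>M) = (\<Sum>h\<in>{..t} \<rightarrow>\<^sub>E UNIV. \<integral>\<^sup>+w. f w * indicator (history t h) w \<partial>M)"
proof -
  have "(\<integral>\<^sup>+w. f w \<partial>M) = (\<integral>\<^sup>+w. (\<Sum>h\<in>{..t} \<rightarrow>\<^sub>E UNIV. f w * indicator (history t h) w) \<partial>M)"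
  proof (rule nn_integral_cong)
    fix w assume w: "w \<in> space M"
    have "(\<Sum>h\<in>{..t} \<rightarrow>\<^sub>E UNIV. indicator (history t h) w)
        = (\<Sum>h\<in>{..t} \<rightarrow>\<^sub>E UNIV. if h = restrict (\<lambda>s. \<omega> s w) {..t} then 1 else 0 :: ennreal)"
      using w by (intro sum.cong refl) (auto simp: indicator_def history_def PiE_iff extensional_def fun_eq_iff)
    also have "\<dots> = 1"
      by (simp add: finite_PiE)
    finally show "f w = (\<Sum>h\<in>{..t} \<rightarrow>\<^sub>E UNIV. f w * indicator (history t h) w)"
      by (simp add: sum_distrib_left[symmetric])
  qed
  also have "\<dots> = (\<Sum>h\<in>{..t} \<rightarrow>\<^sub>E UNIV. \<integral>\<^sup>+w. f w * indicator (history t h) w \<partial>M)"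
    by (rule nn_integral_sum) measurable
  finally show ?thesis .
qed

text \<open>Conditioning on the next mode, proved history by history: on each one the state is a
  function of \<open>x0\<close> alone, so independence and the one-step transition law
  suffice.\<close>

lemma nn_integral_markov:
  fixes f :: "'s \<Rightarrow> 's \<Rightarrow> real ^ 'd \<Rightarrow> ennreal"
  assumes f[measurable]: "\<And>i j. f i j \<in> borel_measurable borel"
  shows "(\<integral>\<^sup>+w. f (\<omega> t w) (\<omega> (Suc t) w) (x t w) \<partial>M)
    = (\<integral>\<^sup>+w. (\<Sum>j\<in>UNIV. p (\<omega> t w) j * f (\<omega> t w) j (x t w)) \<partial>M)"
proof -
  have meas[measurable]: "(\<lambda>w. g (\<omega> t w) (\<omega> (Suc t) w) (x t w)) \<in> borel_measurable M"
    if "\<And>i j. g i j \<in> borel_measurable borel" for g :: "'s \<Rightarrow> 's \<Rightarrow> real ^ 'd \<Rightarrow> ennreal"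
  proof -
    note [measurable] = that
    have "(\<lambda>w. g i (\<omega> (Suc t) w) (x t w)) \<in> borel_measurable M" for i
      by (rule measurable_compose_countable[where f = "\<lambda>j w. g i j (x t w)"]) measurable
    then show ?thesis
      by (rule measurable_compose_countable[where f = "\<lambda>i w. g i (\<omega> (Suc t) w) (x t w)"]) measurable
  qed
  have step: "(\<integral>\<^sup>+w. f (\<omega> t w) (\<omega> (Suc t) w) (x t w) * indicator (history t h) w \<partial>M)
      = (\<integral>\<^sup>+w. (\<Sum>j\<in>UNIV. p (\<omega> t w) j * f (\<omega> t w) j (x t w)) * indicator (history t h) w \<partial>M)" for h
  proof -
    define g where "g j v = f (h t) j (transition h t *v v)" for j v
    have [measurable]: "(\<lambda>v. transition h t *v v) \<in> borel_measurable borel"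
      by (intro borel_measurable_continuous_onI matrix_vector_mult_linear_continuous_on)
    have g[measurable]: "g j \<in> borel_measurable borel" for j
      unfolding g_def by measurable
    \<comment> \<open>\<open>?h j\<close> prolongs the history by the mode \<open>j\<close> without
      altering it up to time \<open>t\<close>.\<close>
    let ?h = "\<lambda>j. h(Suc t := j)"
    have hist: "history t (?h j) = history t h" for j
      by (auto simp: history_def)
    have "(\<integral>\<^sup>+w. f (\<omega> t w) (\<omega> (Suc t) w) (x t w) * indicator (history t h) w \<partial>M)
        = (\<integral>\<^sup>+w. (\<Sum>j\<in>UNIV. g j (x0 w) * indicator (history (Suc t) (?h j)) w) \<partial>M)"
    proof (rule nn_integral_cong)
      fix w assume w: "w \<in> space M"
      have ind: "indicator (history (Suc t) (?h j)) w
          = (if \<omega> (Suc t) w = j then indicator (history t h) w else 0 :: ennreal)" for j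
        using w by (auto simp: history_def indicator_def le_Suc_eq)
      have "(\<Sum>j\<in>UNIV. g j (x0 w) * indicator (history (Suc t) (?h j)) w)
          = (\<Sum>j\<in>UNIV. if \<omega> (Suc t) w = j then g j (x0 w) * indicator (history t h) w else 0)"
        unfolding ind by (intro sum.cong refl) simp
      also have "\<dots> = g (\<omega> (Suc t) w) (x0 w) * indicator (history t h) w"
        by simp
      also have "\<dots> = f (\<omega> t w) (\<omega> (Suc t) w) (x t w) * indicator (history t h) w"
        using x_on_history[of w t h] by (auto simp: g_def indicator_def history_def)
      finally show "f (\<omega> t w) (\<omega> (Suc t) w) (x t w) * indicator (history t h) w
          = (\<Sum>j\<in>UNIV. g j (x0 w) * indicator (history (Suc t) (?h j)) w)" ..
    qed
    also have "\<dots> = (\<Sum>j\<in>UNIV. \<integral>\<^sup>+w. g j (x0 w) * indicator (history (Suc t) (?h j)) w \<partial>M)"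
      by (rule nn_integral_sum) measurable
    \<comment> \<open>Independence pulls out the probability of the longer history, the Markov
      property splits off \<open>p (h t) j\<close>, and independence puts the shorter history
      back.\<close>
    also have "\<dots> = (\<Sum>j\<in>UNIV. p (h t) j * (\<integral>\<^sup>+w. g j (x0 w) * indicator (history t h) w \<partial>M))"
      by (simp add: nn_integral_on_history emeasure_history_Suc hist mult_ac)
    also have "\<dots> = (\<integral>\<^sup>+w. (\<Sum>j\<in>UNIV. p (h t) j * (g j (x0 w) * indicator (history t h) w)) \<partial>M)"
      by (simp add: nn_integral_sum nn_integral_cmult)
    also have "\<dots> = (\<integral>\<^sup>+w. (\<Sum>j\<in>UNIV. p (\<omega> t w) j * f (\<omega> t w) j (x t w)) * indicator (history t h) w \<partial>M)"
    proof (rule nn_integral_cong)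
      fix w
      show "(\<Sum>j\<in>UNIV. p (h t) j * (g j (x0 w) * indicator (history t h) w))
          = (\<Sum>j\<in>UNIV. p (\<omega> t w) j * f (\<omega> t w) j (x t w)) * indicator (history t h) w"
      proof (cases "w \<in> history t h")
        case True
        moreover from True have "\<omega> t w = h t" by (simp add: history_def)
        ultimately show ?thesis by (simp add: g_def x_on_history[OF True])
      qed simp
    qed
    finally show ?thesis .
  qed
  have [measurable]: "(\<lambda>w. \<Sum>j\<in>UNIV. p (\<omega> t w) j * f (\<omega> t w) j (x t w)) \<in> borel_measurable M"
    by (rule meas) measurable
  show ?thesis
    by (subst (1 2) nn_integral_split_history[where t = t]) (simp_all add: step meas f)
qed

section \<open>The energy of the state\<close>

text \<open>\<open>energy_to_go n i v\<close> is the expected squared norm of the state after \<open>n\<close> steps from mode \<open>i\<close>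
  and state \<open>v\<close>.\<close>

primrec energy_to_go :: "nat \<Rightarrow> 's \<Rightarrow> real ^ 'd \<Rightarrow> real" where
  "energy_to_go 0 i v = (norm v)\<^sup>2"
| "energy_to_go (Suc n) i v = (\<Sum>j\<in>UNIV. p i j * energy_to_go n j (closed_loop i *v v))"

lemma energy_to_go_nonneg: "0 \<le> energy_to_go n i v"
  by (induction n arbitrary: i v) (auto intro!: sum_nonneg mult_nonneg_nonneg p_nonneg)

lemma energy_to_go_measurable [measurable]: "energy_to_go n i \<in> borel_measurable borel"
proof (induction n arbitrary: i)
  case 0
  then show ?case
    by (simp add: energy_to_go.simps(1)[abs_def])
next
  case (Suc n)
  have "(\<lambda>v. \<Sum>j\<in>UNIV. p i j * energy_to_go n j (closed_loop i *v v)) \<in> borel_measurable borel"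
    by (intro borel_measurable_sum borel_measurable_times borel_measurable_const
        measurable_compose[OF closed_loop_measurable Suc])
  then show ?case
    by (simp add: energy_to_go.simps(2)[abs_def])
qed

text \<open>A nonnegative quadratic form is bounded by its trace times the squared norm. The matrix
  \<open>L\<close> is carried along because each step of the recursion multiplies it by a
  closed-loop matrix.\<close>

lemma energy_to_go_le:
  "energy_to_go n i (L *v v) \<le> (\<Sum>k\<in>UNIV. energy_to_go n i (L *v axis k 1)) * (norm v)\<^sup>2"
proof (induction n arbitrary: i L)
  case 0
  have "(norm (L *v v))\<^sup>2 \<le> (norm L * norm v)\<^sup>2"
    by (intro power_mono norm_matrix_vector_mult_le) simp
  then show ?case
    by (simp add: power_mult_distrib norm_squared_eq_sum_columns[symmetric])
next
  case (Suc n)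
  have "energy_to_go (Suc n) i (L *v v)
      = (\<Sum>j\<in>UNIV. p i j * energy_to_go n j ((closed_loop i ** L) *v v))"
    by (simp add: matrix_vector_mul_assoc)
  also have "\<dots> \<le> (\<Sum>j\<in>UNIV. p i j *
      ((\<Sum>k\<in>UNIV. energy_to_go n j ((closed_loop i ** L) *v axis k 1)) * (norm v)\<^sup>2))"
    by (intro sum_mono mult_left_mono Suc p_nonneg)
  also have "\<dots> = (\<Sum>j\<in>UNIV. \<Sum>k\<in>UNIV. p i j * energy_to_go n j ((closed_loop i ** L) *v axis k 1)) * (norm v)\<^sup>2"
    by (simp add: sum_distrib_left sum_distrib_right mult.assoc)
  also have "\<dots> = (\<Sum>k\<in>UNIV. energy_to_go (Suc n) i (L *v axis k 1)) * (norm v)\<^sup>2"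
    by (subst sum.swap) (simp add: matrix_vector_mul_assoc)
  finally show ?case .
qed

text \<open>If the second moment of \<open>x0\<close> dominates \<open>s\<close> times the identity,
  the mean of a nonnegative quadratic form in \<open>x0\<close> is at least \<open>s\<close> times
  its trace. Both sides obey the same recursion in \<open>n\<close>, so only the Frobenius case
  \<open>n = 0\<close> needs the hypothesis on \<open>s\<close>.\<close>

lemma energy_to_go_initial_ge:
  assumes "0 \<le> s" and s: "\<And>u. ennreal (s * (norm u)\<^sup>2) \<le> (\<integral>\<^sup>+w. ennreal ((u \<bullet> x0 w)\<^sup>2) \<partial>M)"
  shows "ennreal (s * (\<Sum>k\<in>UNIV. energy_to_go n i (L *v axis k 1)))
    \<le> (\<integral>\<^sup>+w. ennreal (energy_to_go n i (L *v x0 w)) \<partial>M)"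
proof (induction n arbitrary: i L)
  case 0
  have "ennreal (s * (\<Sum>k\<in>UNIV. energy_to_go 0 i (L *v axis k 1))) = ennreal (s * (\<Sum>r\<in>UNIV. (norm (L $ r))\<^sup>2))"
    by (simp add: norm_squared_eq_sum_columns[symmetric] norm_vec_squared[of L])
  also have "\<dots> = (\<Sum>r\<in>UNIV. ennreal (s * (norm (L $ r))\<^sup>2))"
    using \<open>0 \<le> s\<close> by (simp add: sum_distrib_left)
  \<comment> \<open>The hypothesis is applied with \<open>u\<close> equal to each row of
    \<open>L\<close>.\<close>
  also have "\<dots> \<le> (\<Sum>r\<in>UNIV. \<integral>\<^sup>+w. ennreal ((L $ r \<bullet> x0 w)\<^sup>2) \<partial>M)"
    by (intro sum_mono s)
  also have "\<dots> = (\<integral>\<^sup>+w. ennreal (energy_to_go 0 i (L *v x0 w)) \<partial>M)"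
    by (subst nn_integral_sum[symmetric])
      (simp_all add: norm_vec_squared[of "L *v _"] matrix_vector_mul_component)
  finally show ?case .
next
  case (Suc n)
  let ?L = "closed_loop i ** L"
  have [measurable]: "(\<lambda>v. ?L *v v) \<in> borel_measurable borel"
    by (intro borel_measurable_continuous_onI matrix_vector_mult_linear_continuous_on)
  have "s * (\<Sum>k\<in>UNIV. energy_to_go (Suc n) i (L *v axis k 1))
      = (\<Sum>j\<in>UNIV. p i j * (s * (\<Sum>k\<in>UNIV. energy_to_go n j (?L *v axis k 1))))"
    by (simp add: matrix_vector_mul_assoc sum_distrib_left mult.left_commute) (rule sum.swap)
  then have "ennreal (s * (\<Sum>k\<in>UNIV. energy_to_go (Suc n) i (L *v axis k 1)))
      = (\<Sum>j\<in>UNIV. ennreal (p i j) * ennreal (s * (\<Sum>k\<in>UNIV. energy_to_go n j (?L *v axis k 1))))"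
    using \<open>0 \<le> s\<close>
    by (simp add: ennreal_mult[symmetric] p_nonneg energy_to_go_nonneg sum_nonneg)
  also have "\<dots> \<le> (\<Sum>j\<in>UNIV. ennreal (p i j) * (\<integral>\<^sup>+w. ennreal (energy_to_go n j (?L *v x0 w)) \<partial>M))"
    by (intro sum_mono mult_left_mono Suc) simp
  also have "\<dots> = (\<integral>\<^sup>+w. (\<Sum>j\<in>UNIV. ennreal (p i j) * ennreal (energy_to_go n j (?L *v x0 w))) \<partial>M)"
    by (simp add: nn_integral_sum nn_integral_cmult)
  also have "\<dots> = (\<integral>\<^sup>+w. ennreal (energy_to_go (Suc n) i (L *v x0 w)) \<partial>M)"
    by (simp add: ennreal_mult[symmetric] p_nonneg energy_to_go_nonneg matrix_vector_mul_assoc)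
  finally show ?case .
qed

section \<open>Second moments over time and their submultiplicativity\<close>

definition energy :: "nat \<Rightarrow> ennreal" where
  "energy t = (\<integral>\<^sup>+w. ennreal ((norm (x t w))\<^sup>2) \<partial>M)"

text \<open>Peeling off one step: the induction hypothesis at time \<open>Suc t\<close> is averaged
  over the next mode by the Markov property, which is the recursion of
  \<open>energy_to_go\<close>.\<close>

lemma energy_add: "energy (t + n) = (\<integral>\<^sup>+w. ennreal (energy_to_go n (\<omega> t w) (x t w)) \<partial>M)"
proof (induction n arbitrary: t)
  case (Suc n)
  have "energy (t + Suc n)
      = (\<integral>\<^sup>+w. ennreal (energy_to_go n (\<omega> (Suc t) w) (closed_loop (\<omega> t w) *v x t w)) \<partial>M)"
    using Suc[of "Suc t"] by (simp add: x_Suc)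
  also have "\<dots> = (\<integral>\<^sup>+w. (\<Sum>j\<in>UNIV. ennreal (p (\<omega> t w) j) *
      ennreal (energy_to_go n j (closed_loop (\<omega> t w) *v x t w))) \<partial>M)"
    by (rule nn_integral_markov[where f = "\<lambda>i j v. ennreal (energy_to_go n j (closed_loop i *v v))"]) measurable
  also have "\<dots> = (\<integral>\<^sup>+w. ennreal (energy_to_go (Suc n) (\<omega> t w) (x t w)) \<partial>M)"
    by (simp add: ennreal_mult[symmetric] p_nonneg energy_to_go_nonneg)
  finally show ?case .
qed (simp add: energy_def)

lemma nn_integral_initial:
  fixes f :: "'s \<Rightarrow> real ^ 'd \<Rightarrow> ennreal"
  assumes [measurable]: "\<And>i. f i \<in> borel_measurable borel"
  shows "(\<integral>\<^sup>+w. f (\<omega> 0 w) (x0 w) \<partial>M) = (\<Sum>i\<in>UNIV. (\<integral>\<^sup>+w. f i (x0 w) \<partial>M) * ennreal (\<pi> i))"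
proof -
  have hist: "history 0 (\<lambda>_. i) = {w \<in> space M. \<omega> 0 w = i}" for i
    by (simp add: history_def)
  have "(\<integral>\<^sup>+w. f (\<omega> 0 w) (x0 w) \<partial>M) = (\<integral>\<^sup>+w. (\<Sum>i\<in>UNIV. f i (x0 w) * indicator (history 0 (\<lambda>_. i)) w) \<partial>M)"
  proof (rule nn_integral_cong)
    fix w assume w: "w \<in> space M"
    have "(\<Sum>i\<in>UNIV. f i (x0 w) * indicator (history 0 (\<lambda>_. i)) w)
        = (\<Sum>i\<in>UNIV. if \<omega> 0 w = i then f i (x0 w) else 0)"
      using w by (intro sum.cong refl) (simp add: hist indicator_def)
    then show "f (\<omega> 0 w) (x0 w) = (\<Sum>i\<in>UNIV. f i (x0 w) * indicator (history 0 (\<lambda>_. i)) w)"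
      by simp
  qed
  also have "\<dots> = (\<Sum>i\<in>UNIV. \<integral>\<^sup>+w. f i (x0 w) * indicator (history 0 (\<lambda>_. i)) w \<partial>M)"
    by (rule nn_integral_sum) measurable
  also have "\<dots> = (\<Sum>i\<in>UNIV. (\<integral>\<^sup>+w. f i (x0 w) \<partial>M) * ennreal (\<pi> i))"
    using chain unfolding nn_integral_on_history[OF assms]
    unfolding emeasure_eq_measure hist
    by (simp add: markov_chain_def)
  finally show ?thesis .
qed

text \<open>The same constant, the sum of the traces over all modes, serves both directions: it
  bounds growth from any time \<open>t\<close>, and at time 0 independence and
  \<open>m \<le> \<pi> i\<close> make each mode contribute at least \<open>m * s\<close> times its
  trace.\<close>

lemma energy_submultiplicative:
  assumes "0 \<le> s" and s: "\<And>u. ennreal (s * (norm u)\<^sup>2) \<le> (\<integral>\<^sup>+w. ennreal ((u \<bullet> x0 w)\<^sup>2) \<partial>M)"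
    and "0 \<le> m" and m: "\<And>i. m \<le> \<pi> i"
  shows "ennreal (m * s) * energy (t + n) \<le> energy t * energy n"
proof -
  define c where "c i = (\<Sum>k\<in>UNIV. energy_to_go n i (axis k 1))" for i
  have c: "0 \<le> c i" for i
    by (simp add: c_def sum_nonneg energy_to_go_nonneg)
  have bound: "energy_to_go n i v \<le> (\<Sum>i\<in>UNIV. c i) * (norm v)\<^sup>2" for i v
  proof -
    have "energy_to_go n i v \<le> c i * (norm v)\<^sup>2"
      using energy_to_go_le[of n i "mat 1" v] by (simp add: c_def)
    \<comment> \<open>The mode at time \<open>t\<close> may depend on the state there, so a bound
      uniform in the mode is required.\<close>
    also have "c i \<le> (\<Sum>i\<in>UNIV. c i)"
      by (rule member_le_sum) (auto simp: c)
    finally show ?thesis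
      by (simp add: mult_right_mono)
  qed
  have "energy (t + n) \<le> (\<integral>\<^sup>+w. ennreal (\<Sum>i\<in>UNIV. c i) * ennreal ((norm (x t w))\<^sup>2) \<partial>M)"
    unfolding energy_add
    by (intro nn_integral_mono) (simp add: ennreal_mult[symmetric] sum_nonneg c bound)
  then have upper: "energy (t + n) \<le> ennreal (\<Sum>i\<in>UNIV. c i) * energy t"
    by (simp add: nn_integral_cmult energy_def)
  have "ennreal (m * s) * ennreal (\<Sum>i\<in>UNIV. c i) = (\<Sum>i\<in>UNIV. ennreal (s * c i) * ennreal m)"
    using assms(1,3) c
    by (simp add: ennreal_mult[symmetric] sum_nonneg sum_distrib_left mult_ac)
  also have "\<dots> \<le> (\<Sum>i\<in>UNIV. (\<integral>\<^sup>+w. ennreal (energy_to_go n i (x0 w)) \<partial>M) * ennreal (\<pi> i))"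
    using energy_to_go_initial_ge[OF assms(1) s, where L = "mat 1" and n = n]
    by (intro sum_mono mult_mono ennreal_leI m) (simp_all add: c_def)
  also have "\<dots> = energy n"
    using nn_integral_initial[of "\<lambda>i v. ennreal (energy_to_go n i v)"] energy_add[of 0 n] by simp
  finally have lower: "ennreal (m * s) * ennreal (\<Sum>i\<in>UNIV. c i) \<le> energy n" .
  have "ennreal (m * s) * energy (t + n) \<le> (ennreal (m * s) * ennreal (\<Sum>i\<in>UNIV. c i)) * energy t"
    using mult_left_mono[OF upper] by (simp add: mult.assoc)
  also have "\<dots> \<le> energy n * energy t"
    by (intro mult_right_mono lower) simp
  finally show ?thesis
    by (simp only: mult.commute)
qed

text \<open>Each of the \<open>Suc l\<close> times \<open>t \<le> l\<close> gives its own bound on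
  the same tail; adding them up produces the factor \<open>Suc l\<close>.\<close>

lemma energy_tail:
  assumes sub: "\<And>t n. c * energy (t + n) \<le> energy t * energy n"
  shows "of_nat (Suc l) * c * (\<Sum>n. energy (Suc l + n)) \<le> (\<Sum>t. energy t)\<^sup>2"
proof -
  let ?T = "\<Sum>n. energy (Suc l + n)" and ?S = "\<Sum>t. energy t"
  have step: "c * ?T \<le> energy t * ?S" if "t \<le> l" for t
  proof -
    \<comment> \<open>Dropping the first \<open>Suc l - t\<close> terms of the series started at
      \<open>t\<close> leaves exactly the tail after \<open>l\<close>.\<close>
    have "(\<Sum>n. energy (t + n)) = (\<Sum>n. energy (t + (n + (Suc l - t)))) + (\<Sum>n<Suc l - t. energy (t + n))"
      by (rule suminf_offset) simp
    moreover have "t + (n + (Suc l - t)) = Suc l + n" for n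
      using that by simp
    ultimately have "?T \<le> (\<Sum>n. energy (t + n))"
      by (simp only: add_increasing2[OF zero_le order_refl])
    then have "c * ?T \<le> (\<Sum>n. c * energy (t + n))"
      by (simp add: mult_left_mono ennreal_suminf_cmult)
    also have "\<dots> \<le> (\<Sum>n. energy t * energy n)"
      by (intro suminf_le sub) auto
    finally show ?thesis
      by (simp add: ennreal_suminf_cmult)
  qed
  have "of_nat (Suc l) * c * ?T = (\<Sum>t\<le>l. c * ?T)"
    by (simp add: mult.assoc)
  also have "\<dots> \<le> (\<Sum>t\<le>l. energy t * ?S)"
    by (intro sum_mono step) simp
  also have "\<dots> = (\<Sum>t\<le>l. energy t) * ?S"
    by (simp add: sum_distrib_right)
  also have "\<dots> \<le> ?S * ?S"
    by (intro mult_right_mono sum_le_suminf) auto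
  finally show ?thesis
    by (simp add: power2_eq_square)
qed

section \<open>Comparison with the cost and with the truncation error\<close>

lemma energy_le_cost:
  assumes Q: "\<And>i v. q * (norm v)\<^sup>2 \<le> v \<bullet> (Q i *v v)" and R: "\<And>i. posdef (R i)" and "0 \<le> q"
  shows "ennreal q * (\<Sum>t. energy t) \<le> cost M A B Q R \<omega> x0 K"
proof -
  have "ennreal q * (\<Sum>t. energy t) = (\<integral>\<^sup>+w. (\<Sum>t. ennreal (q * (norm (x t w))\<^sup>2)) \<partial>M)"
    using \<open>0 \<le> q\<close>
    by (simp add: energy_def ennreal_mult nn_integral_suminf nn_integral_cmult ennreal_suminf_cmult)
  also have "\<dots> \<le> cost M A B Q R \<omega> x0 K"
    unfolding cost_def Let_def
  proof (intro nn_integral_mono suminf_le ennreal_leI summableI)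
    fix w t
    \<comment> \<open>The control cost is nonnegative, so discarding it only lowers the
      total.\<close>
    have "0 \<le> u \<bullet> (R i *v u)" for i u
      using R[of i] by (cases "u = 0") (auto simp: posdef_def less_imp_le)
    with Q show "q * (norm (x t w))\<^sup>2 \<le> x t w \<bullet> (Q (\<omega> t w) *v x t w)
        + control K (\<omega> t w) (x t w) \<bullet> (R (\<omega> t w) *v control K (\<omega> t w) (x t w))"
      by (intro add_increasing2) auto
  qed
  finally show ?thesis .
qed

text \<open>The rank-one matrices have Frobenius norm equal to the squared state norm and the mode
  indicators sum to 1, so summing over the blocks costs neither a dimension factor nor a mode-count
  factor.\<close>

lemma norm_chi_diff_le:
  assumes fin: "(\<Sum>t. energy t) < \<infinity>"
  shows "ennreal (norm (chi_upto M A B \<omega> x0 K l - chi M A B \<omega> x0 K)) \<le> (\<Sum>n. energy (Suc l + n))"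
proof -
  let ?X = "mode_cov M A B \<omega> x0 K"
  define g where "g t = (\<integral>w. (norm (x t w))\<^sup>2 \<partial>M)" for t
  have "energy t \<le> (\<Sum>t. energy t)" for t
    using sum_le_suminf[of energy "{t}"] by simp
  then have "energy t < \<infinity>" for t
    using fin by (rule le_less_trans)
  then have int: "integrable M (\<lambda>w. (norm (x t w))\<^sup>2)" for t
    by (intro integrableI_bounded) (auto simp: energy_def)
  have g: "energy t = ennreal (g t)" for t
    unfolding energy_def g_def by (rule nn_integral_eq_integral[OF int]) simp
  have g_nonneg: "0 \<le> g t" for t
    by (simp add: g_def)
  have summable_g: "summable g"
    using fin g_nonneg by (intro summable_suminf_not_top) (auto simp: g)
  have X_le: "(\<Sum>i\<in>UNIV. norm (?X i t)) \<le> g t" for t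
  proof -
    have int': "integrable M (\<lambda>w. indicator {w. \<omega> t w = i} w * (norm (x t w))\<^sup>2)" for i
      by (rule Bochner_Integration.integrable_bound[OF int[of t]])
        (auto simp: indicator_def)
    have "(\<Sum>i\<in>UNIV. norm (?X i t)) \<le> (\<Sum>i\<in>UNIV. \<integral>w. indicator {w. \<omega> t w = i} w * (norm (x t w))\<^sup>2 \<partial>M)"
      unfolding mode_cov_def
      by (intro sum_mono order_trans[OF integral_norm_bound]) (simp add: norm_outer_self)
    also have "\<dots> = (\<integral>w. (\<Sum>i\<in>UNIV. indicator {w. \<omega> t w = i} w * (norm (x t w))\<^sup>2) \<partial>M)"
      by (rule Bochner_Integration.integral_sum[symmetric]) (rule int')
    also have "\<dots> = g t"
      by (simp add: g_def indicator_def sum_distrib_right[symmetric])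
    finally show ?thesis .
  qed
  have X_le': "norm (?X i t) \<le> g t" for i t
    using member_le_sum[of i UNIV "\<lambda>i. norm (?X i t)"] X_le[of t] by simp
  have sum_norm: "summable (\<lambda>t. norm (?X i t))" for i
    by (rule summable_comparison_test'[OF summable_g, of 0]) (simp add: X_le')
  have sum_norm': "summable (\<lambda>n. norm (?X i (n + Suc l)))" for i
    using sum_norm by (rule summable_ignore_initial_segment)
  have tail: "norm ((\<Sum>t=0..l. ?X i t) - (\<Sum>t. ?X i t)) \<le> (\<Sum>n. norm (?X i (n + Suc l)))" for i
  proof -
    \<comment> \<open>The truncated sum has \<open>Suc l\<close> terms, so the remainder starts at
      \<open>Suc l\<close>.\<close>
    have "(\<Sum>t. ?X i t) = (\<Sum>n. ?X i (n + Suc l)) + (\<Sum>t=0..l. ?X i t)"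
      using suminf_split_initial_segment[OF summable_norm_cancel[OF sum_norm], of i "Suc l"]
      by (simp add: lessThan_Suc_atMost atMost_atLeast0)
    then have "norm ((\<Sum>t=0..l. ?X i t) - (\<Sum>t. ?X i t)) = norm (\<Sum>n. ?X i (n + Suc l))"
      by simp
    also have "\<dots> \<le> (\<Sum>n. norm (?X i (n + Suc l)))"
      by (rule summable_norm[OF sum_norm'])
    finally show ?thesis .
  qed
  have summable_g': "summable (\<lambda>n. g (n + Suc l))"
    using summable_g by (rule summable_ignore_initial_segment)
  have "norm (chi_upto M A B \<omega> x0 K l - chi M A B \<omega> x0 K)
      \<le> (\<Sum>i\<in>UNIV. norm ((\<Sum>t=0..l. ?X i t) - (\<Sum>t. ?X i t)))"
    unfolding chi_upto_def chi_def block_diag_diff by (rule norm_block_diag_le)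
  also have "\<dots> \<le> (\<Sum>i\<in>UNIV. \<Sum>n. norm (?X i (n + Suc l)))"
    by (intro sum_mono tail)
  \<comment> \<open>The sum over modes goes inside so that \<open>X_le\<close> bounds all blocks at
    one time together.\<close>
  also have "\<dots> = (\<Sum>n. \<Sum>i\<in>UNIV. norm (?X i (n + Suc l)))"
    by (rule suminf_sum[symmetric]) (rule sum_norm')
  also have "\<dots> \<le> (\<Sum>n. g (n + Suc l))"
    by (intro suminf_le X_le summable_sum sum_norm' summable_g')
  finally have "ennreal (norm (chi_upto M A B \<omega> x0 K l - chi M A B \<omega> x0 K)) \<le> ennreal (\<Sum>n. g (n + Suc l))"
    by (rule ennreal_leI)
  also have "\<dots> = (\<Sum>n. ennreal (g (n + Suc l)))"
    by (rule suminf_ennreal2[symmetric, OF g_nonneg summable_g'])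
  also have "\<dots> = (\<Sum>n. energy (Suc l + n))"
    by (simp only: g add.commute)
  finally show ?thesis .
qed

end

text \<open>Supplies the constant \<open>s\<close> of \<open>energy_submultiplicative\<close>: the
  quadratic form of the second moment matrix is the mean of the squared projection onto
  \<open>u\<close>.\<close>

lemma nn_integral_inner_squared_ge:
  fixes x0 :: "'w \<Rightarrow> real ^ 'd"
  assumes [measurable]: "x0 \<in> borel_measurable M"
    and int: "integrable (distr M borel x0) (\<lambda>x. outer x x)"
    and pos: "posdef (second_moment (distr M borel x0))"
  shows "ennreal (sigma_min (second_moment (distr M borel x0)) * (norm u)\<^sup>2)
    \<le> (\<integral>\<^sup>+w. ennreal ((u \<bullet> x0 w)\<^sup>2) \<partial>M)"
proof -
  let ?D = "distr M borel x0"
  have lin: "bounded_linear (\<lambda>A :: real ^ 'd ^ 'd. u \<bullet> (A *v u))"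
    by (rule bounded_linear_inner_mult)
  have "sigma_min (second_moment ?D) * (norm u)\<^sup>2 \<le> u \<bullet> (second_moment ?D *v u)"
    using pos by (rule sigma_min_le_form)
  also have "\<dots> = (\<integral>v. (u \<bullet> v)\<^sup>2 \<partial>?D)"
    unfolding second_moment_def integral_bounded_linear[OF lin int, symmetric] inner_outer_mult ..
  finally have "ennreal (sigma_min (second_moment ?D) * (norm u)\<^sup>2) \<le> ennreal (\<integral>v. (u \<bullet> v)\<^sup>2 \<partial>?D)"
    by (rule ennreal_leI)
  also have "\<dots> = (\<integral>\<^sup>+v. ennreal ((u \<bullet> v)\<^sup>2) \<partial>?D)"
    using integrable_bounded_linear[OF lin int] unfolding inner_outer_mult
    by (intro nn_integral_eq_integral[symmetric]) simp_all
  also have "\<dots> = (\<integral>\<^sup>+w. ennreal ((u \<bullet> x0 w)\<^sup>2) \<partial>M)"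
    by (rule nn_integral_distr) measurable
  finally show ?thesis .
qed

theorem lemma2:
  fixes M :: "'w measure"
    and \<omega> :: "nat \<Rightarrow> 'w \<Rightarrow> 's::finite"
    and p :: "'s \<Rightarrow> 's \<Rightarrow> real" and \<pi> :: "'s \<Rightarrow> real"
    and x0 :: "'w \<Rightarrow> real ^ 'd" and D :: "(real ^ 'd) measure"
    and A :: "'s \<Rightarrow> real ^ 'd ^ 'd" and B :: "'s \<Rightarrow> real ^ 'k ^ 'd"
    and Q :: "'s \<Rightarrow> real ^ 'd ^ 'd" and R :: "'s \<Rightarrow> real ^ 'k ^ 'k"
    and K :: "'s \<Rightarrow> real ^ 'd ^ 'k"
    and \<epsilon> :: real and l :: nat
  assumes "prob_space M"
    and "markov_chain M p \<pi> \<omega>"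
    and "x0 \<in> borel_measurable M" and "distr M borel x0 = D"
    and "prob_space.indep_set M
           (sets (vimage_algebra (space M) x0 borel))
           (sets (vimage_algebra (space M) (\<lambda>w t. \<omega> t w) (\<Pi>\<^sub>M t\<in>UNIV. count_space UNIV)))"
    and "\<And>i. posdef (Q i)" and "\<And>i. posdef (R i)"
    and "\<And>i. \<pi> i > 0"
    and "integrable D (\<lambda>x. outer x x)" and "posdef (second_moment D)"
    and "mean_square_stabilizable M A B \<omega>"
    and "\<epsilon> > 0"
    and "cost M A B Q R \<omega> x0 K < \<infinity>"
    and "real l \<ge> real CARD('d) * (enn2real (cost M A B Q R \<omega> x0 K))\<^sup>2
                   / (\<epsilon> * mu \<pi> D * (Lambda_min Q)\<^sup>2)"
  shows "sigma_max (chi_upto M A B \<omega> x0 K l - chi M A B \<omega> x0 K) \<le> \<epsilon>"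
proof -
  interpret prob_space M by fact
  interpret jump_linear_system M \<omega> p \<pi> x0 A B K
    using assms(2,3,5) by unfold_locales
  define m where "m = Min (range \<pi>)"
  define s where "s = sigma_min (second_moment D)"
  define q where "q = Lambda_min Q"
  define C where "C = enn2real (cost M A B Q R \<omega> x0 K)"
  have m: "0 < m" "m \<le> \<pi> i" for i
    using assms(8) by (auto simp: m_def)
  have s: "0 < s" "ennreal (s * (norm u)\<^sup>2) \<le> (\<integral>\<^sup>+w. ennreal ((u \<bullet> x0 w)\<^sup>2) \<partial>M)" for u
    using assms(4,9,10) nn_integral_inner_squared_ge[OF assms(3)] by (auto simp: s_def sigma_min_pos)
  have "0 < q"
    using assms(6) by (auto simp: q_def Lambda_min_def sigma_min_pos)
  have "q * (norm v)\<^sup>2 \<le> v \<bullet> (Q i *v v)" for i v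
  proof -
    have "q * (norm v)\<^sup>2 \<le> sigma_min (Q i) * (norm v)\<^sup>2"
      by (intro mult_right_mono) (auto simp: q_def Lambda_min_def)
    also have "\<dots> \<le> v \<bullet> (Q i *v v)"
      using assms(6) by (rule sigma_min_le_form)
    finally show ?thesis .
  qed
  then have "ennreal q * (\<Sum>t. energy t) \<le> cost M A B Q R \<omega> x0 K"
    using assms(7) \<open>0 < q\<close> by (intro energy_le_cost) auto
  \<comment> \<open>\<open>enn2real\<close> would send an infinite cost to 0; finiteness makes
    \<open>ennreal C\<close> the cost itself.\<close>
  then have qS: "ennreal q * (\<Sum>t. energy t) \<le> ennreal C"
    using assms(13) by (simp add: C_def)
  then have fin: "(\<Sum>t. energy t) < \<infinity>"
    using \<open>0 < q\<close> by (cases "(\<Sum>t. energy t) = \<infinity>") (auto simp: ennreal_mult_top less_top top_unique)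
  \<comment> \<open>The factor for which \<open>energy_tail\<close>, multiplied by the square of
    \<open>q\<close>, bounds \<open>a\<close> times the tail by the square of
    \<open>C\<close>.\<close>
  define a where "a = real (Suc l) * (m * s) * q\<^sup>2"
  have a: "0 < a"
    using m s \<open>0 < q\<close> by (simp add: a_def)
  \<comment> \<open>The dimension is at least 1.\<close>
  have "C\<^sup>2 \<le> real CARD('d) * C\<^sup>2"
    by (simp add: mult_le_cancel_right1 Suc_le_eq)
  also have "\<dots> \<le> real l * (\<epsilon> * (m * s) * q\<^sup>2)"
    using assms(14) \<open>0 < \<epsilon>\<close> m s \<open>0 < q\<close>
    by (simp add: C_def m_def s_def q_def mu_def pos_divide_le_eq)
  also have "\<dots> \<le> real (Suc l) * (\<epsilon> * (m * s) * q\<^sup>2)"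
    using \<open>0 < \<epsilon>\<close> m s by (intro mult_right_mono) (auto simp: less_imp_le)
  finally have C: "C\<^sup>2 \<le> a * \<epsilon>"
    by (simp add: a_def mult_ac)
  have "ennreal a * (\<Sum>n. energy (Suc l + n))
      = (ennreal q)\<^sup>2 * (of_nat (Suc l) * ennreal (m * s) * (\<Sum>n. energy (Suc l + n)))"
    using m s \<open>0 < q\<close>
    by (simp add: a_def ennreal_mult ennreal_power[symmetric] ennreal_of_nat_eq_real_of_nat mult_ac del: of_nat_Suc)
  also have "\<dots> \<le> (ennreal q)\<^sup>2 * (\<Sum>t. energy t)\<^sup>2"
    using m s by (intro mult_left_mono energy_tail energy_submultiplicative) (auto simp: less_imp_le)
  also have "\<dots> \<le> (ennreal C)\<^sup>2"
    using qS by (simp add: power_mult_distrib[symmetric] power_mono)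
  also have "\<dots> \<le> ennreal a * ennreal \<epsilon>"
    using C a \<open>0 < \<epsilon>\<close> by (simp add: C_def ennreal_power ennreal_mult[symmetric] ennreal_leI)
  finally have "(\<Sum>n. energy (Suc l + n)) \<le> ennreal \<epsilon>"
    using a by (simp add: ennreal_mult_le_mult_iff)
  with norm_chi_diff_le[OF fin, of l]
  have "ennreal (norm (chi_upto M A B \<omega> x0 K l - chi M A B \<omega> x0 K)) \<le> ennreal \<epsilon>"
    by (rule order_trans)
  then have "norm (chi_upto M A B \<omega> x0 K l - chi M A B \<omega> x0 K) \<le> \<epsilon>"
    using \<open>0 < \<epsilon>\<close> by simp
  with sigma_max_le_norm show ?thesis
    by (rule order_trans)
qed

end
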